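(* Let $v,k,m,\lambda,t,n$ be positive integers with $t>2$ and $n \le k-t+1$. Let $(X,\mathcal{B})$ be a $t$-$(v,k,m,\lambda)$ general covering design, and let $S$ be a set with $|S|=n$ and $X\cap S=\emptyset$. For every $x\in X$ put $\mathcal{B}(x)=\{B\setminus\{x\} : B\in\mathcal{B},\ x\in B\}$ (as a multiset), and choose $a\in X$ such that $|\mathcal{B}(a)|\le|\mathcal{B}(x)|$ for all $x\in X$. Let $(X\setminus\{a\},\mathcal{C})$ be a $(t-2)$-$(v-1,k-n-1,m-2,\lambda)$ general covering design. Define $\mathcal{B}_1=\mathcal{B}$, $\mathcal{B}_2=\{B\cup\{s\} : B\in\mathcal{B}(a),\ s\in S\}$, $\mathcal{B}_3=\{C\cup S\cup\{a\} : C\in\mathcal{C}\}$. Then $(X\cup S,\ \mathcal{B}_1\cup\mathcal{B}_2\cup\mathcal{B}_3)$ is a $t$-$(v+n,k,m,\lambda)$ general covering design.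
   Context: For positive integers $v,k,m,\lambda,t$ with $v\ge k\ge t$ and $v\ge m\ge t$, a $t$-$(v,k,m,\lambda)$ general covering design is a pair $(X,\mathcal{B})$ where $X$ is a set of $v$ points and $\mathcal{B}$ is a multiset of $k$-subsets of $X$ (blocks) such that every $m$-subset of $X$ intersects at least $\lambda$ members of $\mathcal{B}$ in at least $t$ points. Unions of multisets of blocks are taken so that a block appearing $r_1$ times in one collection and $r_2$ times in another appears $\max\{r_1,r_2\}$ times in the union. *)

theory Defs
  imports Main "HOL-Library.Multiset"
begin

text \<open>Blocks form a finite multiset, so the number of blocks meeting a given \<open>m\<close>-subset in
  at least \<open>t\<close> points is counted with multiplicity.\<close>

definition general_covering_design ::
  "nat \<Rightarrow> nat \<Rightarrow> nat \<Rightarrow> nat \<Rightarrow> nat \<Rightarrow> 'a set \<Rightarrow> 'a set multiset \<Rightarrow> bool" where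
  "general_covering_design t v k m lam X \<B> \<longleftrightarrow>
     0 < v \<and> 0 < k \<and> 0 < m \<and> 0 < lam \<and> 0 < t \<and>
     t \<le> k \<and> k \<le> v \<and> t \<le> m \<and> m \<le> v \<and>
     finite X \<and> card X = v \<and>
     (\<forall>B \<in># \<B>. B \<subseteq> X \<and> card B = k) \<and>
     (\<forall>M. M \<subseteq> X \<and> card M = m \<longrightarrow> lam \<le> size {#B \<in># \<B>. t \<le> card (B \<inter> M)#})"

definition derived_blocks :: "'a set multiset \<Rightarrow> 'a \<Rightarrow> 'a set multiset" where
  "derived_blocks \<B> x = {#B - {x}. B \<in># {#B \<in># \<B>. x \<in> B#}#}"

end

theory Submission
  imports Defs
begin

text \<open>Let \<open>j = card (M \<inter> S)\<close> for an \<open>m\<close>-subset \<open>M\<close> of \<open>X \<union> S\<close>. If \<open>j = 0\<close>, the blocks of \<open>\<B>\<close> suffice.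
  If \<open>M = insert s M'\<close> with \<open>s \<in> S\<close>, \<open>M' \<subseteq> X - {a}\<close>, take the blocks of \<open>\<B>\<close> that cover \<open>insert a M'\<close>
  and exchange \<open>a\<close> for \<open>s\<close> in those that contain \<open>a\<close>. In the remaining cases \<open>M\<close> meets
  \<open>S \<union> {a}\<close> in at least two points, so that \<open>M \<inter> (X - {a})\<close> extends to an \<open>(m - 2)\<close>-subset of
  \<open>X - {a}\<close>, and the blocks of \<open>\<C>\<close> covering it gain enough points from \<open>S \<union> {a}\<close>.\<close>

lemma general_covering_designD:
  assumes "general_covering_design t v k m lam X \<B>"
  shows "0 < k" "t \<le> k" "k \<le> v" "t \<le> m" "m \<le> v" "finite X" "card X = v"
    and "\<And>B. B \<in># \<B> \<Longrightarrow> B \<subseteq> X" "\<And>B. B \<in># \<B> \<Longrightarrow> card B = k"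
    and "\<And>M. M \<subseteq> X \<Longrightarrow> card M = m \<Longrightarrow> lam \<le> size {#B \<in># \<B>. t \<le> card (B \<inter> M)#}"
  using assms unfolding general_covering_design_def by auto

lemma size_filter_image_mset:
  "size (filter_mset P (image_mset f N)) = size {#x \<in># N. P (f x)#}"
  by (simp add: filter_mset_image_mset)

lemma size_filter_mset_mono:
  assumes "\<And>x. x \<in># N \<Longrightarrow> P x \<Longrightarrow> Q x"
  shows "size (filter_mset P N) \<le> size (filter_mset Q N)"
  using assms by (induction N) auto

lemma size_filter_mset_subset_mono:
  "N \<subseteq># N' \<Longrightarrow> size (filter_mset P N) \<le> size (filter_mset P N')"
  by (intro size_mset_mono multiset_filter_mono)

text \<open>Both intersections consist of \<open>B \<inter> (N - {a})\<close> and one further point,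
  \<open>a\<close> or \<open>s\<close>, so their sizes even agree. Taking \<open>N - {a}\<close>
  allows for \<open>a \<in> N\<close>.\<close>

lemma card_insert_remove_Int_ge:
  assumes "finite B" and "a \<in> B" and "s \<notin> B" and "s \<notin> N"
  shows "card (B \<inter> insert a N) \<le> card ((B - {a} \<union> {s}) \<inter> insert s N)"
proof -
  have "B \<inter> insert a N = insert a (B \<inter> (N - {a}))" 
    and "(B - {a} \<union> {s}) \<inter> insert s N = insert s (B \<inter> (N - {a}))"
    using assms by auto
  then show ?thesis using assms by simp
qed

text \<open>Each block of \<open>\<B>\<close> that covers \<open>insert a M\<close> yields one block
  that covers \<open>insert s M\<close>: itself if it avoids \<open>a\<close>, its exchanged copy
  otherwise. The image multiset keeps multiplicities, so the count does not drop.\<close>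

lemma exchange_covering:
  assumes B: "general_covering_design t v k m lam X \<B>"
    and "a \<in> X" and "s \<notin> X" and M: "M \<subseteq> X - {a}" "card M = m - 1" "0 < m"
  shows "lam \<le> size {#B \<in># \<B> \<union># {#B \<union> {s}. B \<in># derived_blocks \<B> a#}. t \<le> card (B \<inter> insert s M)#}"
proof -
  note BD = general_covering_designD[OF B]
  let ?I = "{#B \<union> {s}. B \<in># derived_blocks \<B> a#}"
  let ?P = "\<lambda>B. t \<le> card (B \<inter> insert a M)"
  let ?Q = "\<lambda>B. t \<le> card (B \<inter> insert s M)"
  have fin: "finite M" "finite B" if "B \<in># \<B>" for B
    using M BD(6) BD(8)[OF that] by (auto intro: finite_subset)
  have "finite M" using M BD(6) by (auto intro: finite_subset)
  then have "card (insert a M) = m" using M by (subst card_insert_disjoint) auto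
  then have "lam \<le> size (filter_mset ?P \<B>)"
    using M \<open>a \<in> X\<close> by (intro BD(10)) auto
  also have "\<dots> = size (filter_mset ?P {#B \<in># \<B>. a \<notin> B#}) + size (filter_mset ?P {#B \<in># \<B>. a \<in> B#})"
    by (simp flip: size_union filter_union_mset)
  also have "\<dots> \<le> size (filter_mset ?Q \<B>) + size (filter_mset ?Q ?I)"
  proof (rule add_mono)
    have "size (filter_mset ?P {#B \<in># \<B>. a \<notin> B#}) \<le> size (filter_mset ?Q {#B \<in># \<B>. a \<notin> B#})"
    proof (rule size_filter_mset_mono)
      fix B assume "B \<in># {#B \<in># \<B>. a \<notin> B#}" "?P B"
      moreover from this have "card (B \<inter> insert a M) \<le> card (B \<inter> insert s M)"
        using fin by (intro card_mono) auto
      ultimately show "?Q B" by linarith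
    qed
    also have "\<dots> \<le> size (filter_mset ?Q \<B>)"
      by (intro size_filter_mset_subset_mono) simp
    finally show "size (filter_mset ?P {#B \<in># \<B>. a \<notin> B#}) \<le> size (filter_mset ?Q \<B>)" .
    have "size (filter_mset ?P {#B \<in># \<B>. a \<in> B#})
        \<le> size {#B \<in># {#B \<in># \<B>. a \<in> B#}. ?Q (B - {a} \<union> {s})#}"
    proof (rule size_filter_mset_mono)
      fix B assume B: "B \<in># {#B \<in># \<B>. a \<in> B#}" "?P B"
      then have "card (B \<inter> insert a M) \<le> card ((B - {a} \<union> {s}) \<inter> insert s M)"
        using fin BD(8)[of B] \<open>s \<notin> X\<close> M by (intro card_insert_remove_Int_ge) auto
      then show "?Q (B - {a} \<union> {s})" using B(2) by linarith
    qed
    also have "\<dots> = size (filter_mset ?Q ?I)"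
      unfolding derived_blocks_def size_filter_image_mset ..
    finally show "size (filter_mset ?P {#B \<in># \<B>. a \<in> B#}) \<le> size (filter_mset ?Q ?I)" .
  qed
  also have "\<dots> = size (filter_mset ?Q (\<B> + ?I))"
    by simp
  \<comment> \<open>All blocks of \<open>?I\<close> contain \<open>s\<close>, whereas those of
    \<open>\<B>\<close> lie in \<open>X\<close>. Without common blocks, the maximum of two
    multiplicities is their sum.\<close>
  also have "\<B> + ?I = \<B> \<union># ?I"
  proof -
    have "\<B> \<inter># ?I = {#}"
      using BD(8) \<open>s \<notin> X\<close> by (auto simp: disjunct_not_in)
    then show ?thesis using union_diff_inter_eq_sup[of \<B> ?I] by simp
  qed
  finally show ?thesis .
qed

text \<open>Passing from an \<open>(m - 2)\<close>-set \<open>N\<close> containing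
  \<open>M \<inter> Y\<close> back to \<open>M\<close> costs a block at most
  \<open>m - 2 - card (M \<inter> Y)\<close> points; adjoining \<open>T\<close> gains
  \<open>card (M \<inter> T) = m - card (M \<inter> Y)\<close> points. The net gain is at least
  two.\<close>

lemma extended_covering:
  assumes C: "general_covering_design (t - 2) (card Y) k' (m - 2) lam Y \<C>"
    and "finite T" and "Y \<inter> T = {}" and M: "M \<subseteq> Y \<union> T" "card M = m"
    and two: "2 \<le> card (M \<inter> T)"
  shows "lam \<le> size {#B \<in># {#C \<union> T. C \<in># \<C>#}. t \<le> card (B \<inter> M)#}"
proof -
  note CD = general_covering_designD[OF C]
  have fin: "finite M" using CD(6) \<open>finite T\<close> M(1) by (auto intro: finite_subset)
  have split: "card (M \<inter> Y) + card (M \<inter> T) = m"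
  proof -
    have "M = (M \<inter> Y) \<union> (M \<inter> T)" using M by auto
    moreover have "card ((M \<inter> Y) \<union> (M \<inter> T)) = card (M \<inter> Y) + card (M \<inter> T)"
      using fin \<open>Y \<inter> T = {}\<close> by (intro card_Un_disjoint) auto
    ultimately show ?thesis using M(2) by simp
  qed
  \<comment> \<open>\<open>M \<inter> Y\<close> may be too small for the covering property of
    \<open>\<C>\<close>, hence the padding to \<open>N\<close>. By \<open>two\<close>, the
    subtraction \<open>m - 2\<close> is not truncated.\<close>
  have "card (M \<inter> Y) \<le> m - 2" using split two by linarith
  then obtain N where N: "M \<inter> Y \<subseteq> N" "N \<subseteq> Y" "card N = m - 2"
    using exists_subset_between[OF _ CD(5) inf_le2 CD(6), of M] by metis
  have finN: "finite N" using N CD(6) finite_subset by blast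
  have "t \<le> card ((C \<union> T) \<inter> M)" if "C \<in># \<C>" "t - 2 \<le> card (C \<inter> N)" for C
  proof -
    have "C \<subseteq> Y" using CD(8) that by blast
    then have "C \<inter> N \<subseteq> (C \<inter> M) \<union> (N - (M \<inter> Y))" by auto
    then have "card (C \<inter> N) \<le> card (C \<inter> M) + card (N - (M \<inter> Y))"
      using fin finN by (intro order_trans[OF card_mono card_Un_le]) auto
    also have "card (N - (M \<inter> Y)) = m - 2 - card (M \<inter> Y)"
      using N fin by (simp add: card_Diff_subset)
    finally have "t \<le> card (C \<inter> M) + card (M \<inter> T)"
      using split two that(2) by linarith
    also have "\<dots> = card ((C \<inter> M) \<union> (M \<inter> T))"
      using fin \<open>C \<subseteq> Y\<close> \<open>Y \<inter> T = {}\<close> by (subst card_Un_disjoint) auto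
    also have "(C \<inter> M) \<union> (M \<inter> T) = (C \<union> T) \<inter> M" by auto
    finally show ?thesis .
  qed
  then have "size {#C \<in># \<C>. t - 2 \<le> card (C \<inter> N)#} \<le> size {#C \<in># \<C>. t \<le> card ((C \<union> T) \<inter> M)#}"
    by (intro size_filter_mset_mono) auto
  then show ?thesis
    using CD(10)[OF N(2,3)] by (simp add: size_filter_image_mset)
qed

theorem theorem11:
  fixes v k m lam t n :: nat
    and X S :: "'a set" and a :: 'a
    and \<B> \<B>\<^sub>1 \<B>\<^sub>2 \<B>\<^sub>3 \<C> :: "'a set multiset"
  assumes "v > 0" "k > 0" "m > 0" "lam > 0" "t > 0" "n > 0"
    and "t > 2" and "n \<le> k - t + 1"
    and "general_covering_design t v k m lam X \<B>"
    and "finite S" and "card S = n" and "X \<inter> S = {}"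
    and "a \<in> X"
    and "\<forall>x\<in>X. size (derived_blocks \<B> a) \<le> size (derived_blocks \<B> x)"
    and "general_covering_design (t - 2) (v - 1) (k - n - 1) (m - 2) lam (X - {a}) \<C>"
    and "\<B>\<^sub>1 = \<B>"
    and "\<B>\<^sub>2 = (\<Sum>s\<in>S. {#B \<union> {s}. B \<in># derived_blocks \<B> a#})"
    and "\<B>\<^sub>3 = {#C \<union> S \<union> {a}. C \<in># \<C>#}"
  shows "general_covering_design t (v + n) k m lam (X \<union> S) (\<B>\<^sub>1 \<union># \<B>\<^sub>2 \<union># \<B>\<^sub>3)"
proof -
  note BD = general_covering_designD[OF assms(9)]
  note CD = general_covering_designD[OF assms(15)]
  note fin = BD(6) \<open>finite S\<close>
  have disj: "X \<inter> S = {}" and a: "a \<in> X" and cardS: "card S = n" by fact+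
  let ?U = "\<B>\<^sub>1 \<union># \<B>\<^sub>2 \<union># \<B>\<^sub>3"
  have block: "B \<subseteq> X \<union> S \<and> card B = k" if "B \<in># ?U" for B
  proof -
    consider "B \<in># \<B>" | s A where "s \<in> S" "A \<in># \<B>" "a \<in> A" "B = A - {a} \<union> {s}"
      | C where "C \<in># \<C>" "B = C \<union> S \<union> {a}"
      using \<open>B \<in># ?U\<close> assms(16-18) fin by (auto simp: derived_blocks_def set_mset_sum)
    then show ?thesis
    proof cases
      case 1
      then show ?thesis using BD(8,9) by blast
    next
      case 2
      then have A: "A \<subseteq> X" "card A = k" "finite A" using BD(8,9) fin finite_subset by blast+
      moreover have "s \<notin> A" using A 2 disj by auto
      ultimately show ?thesis using 2 \<open>k > 0\<close> by (auto simp: card_Diff_singleton)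
    next
      case 3
      then have C: "C \<subseteq> X - {a}" "card C = k - n - 1" using CD(8,9) by blast+
      moreover have "finite C" using C fin finite_subset by blast
      moreover have "C \<inter> S = {}" "a \<notin> C \<union> S" using C disj a by auto
      \<comment> \<open>\<open>CD(1)\<close> says \<open>0 < k - n - 1\<close>, so the subtraction
        is exact and adding the \<open>n + 1\<close> new points gives \<open>k\<close>.\<close>
      ultimately show ?thesis using 3 CD(1) fin cardS a
        by (auto simp: card_Un_disjoint)
    qed
  qed
  have cover: "lam \<le> size {#B \<in># ?U. t \<le> card (B \<inter> M)#}" if M: "M \<subseteq> X \<union> S" "card M = m" for M
  proof -
    have finM: "finite M" using M fin finite_subset by blast
    \<comment> \<open>The union by maximum contains each of its parts, so in every case it is enough
      to count in a suitable sub-multiset.\<close>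
    have mono: "lam \<le> size {#B \<in># ?U. t \<le> card (B \<inter> M)#}"
      if "lam \<le> size {#B \<in># N. t \<le> card (B \<inter> M)#}" "N \<subseteq># ?U" for N
      using that size_filter_mset_subset_mono order_trans by blast
    consider "M \<subseteq> X" | s where "s \<in> M \<inter> S" "M - {s} \<subseteq> X - {a}" | "2 \<le> card (M \<inter> insert a S)"
    proof (cases "M \<inter> S = {}")
      case False
      then obtain s where s: "s \<in> M" "s \<in> S" by auto
      show ?thesis
      proof (cases "M - {s} \<subseteq> X - {a}")
        case False
        \<comment> \<open>A point of \<open>M - {s}\<close> outside \<open>X - {a}\<close> is either
          \<open>a\<close> or a second point of \<open>S\<close>.\<close>
        then obtain y where "y \<in> M \<inter> insert a S" "y \<noteq> s" using M(1) by blast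
        then have "card {s, y} \<le> card (M \<inter> insert a S)"
          using s finM by (intro card_mono) auto
        then show ?thesis using that(3) \<open>y \<noteq> s\<close> by simp
      qed (use that(2) s in auto)
    qed (use that(1) M(1) in auto)
    then show ?thesis
    proof cases
      case 1
      then have "lam \<le> size {#B \<in># \<B>. t \<le> card (B \<inter> M)#}" using BD(10) M by blast
      then show ?thesis
        by (rule mono) (simp add: assms(16) subseteq_mset_def le_max_iff_disj)
    next
      case 2
      let ?I = "\<lambda>s. {#B \<union> {s}. B \<in># derived_blocks \<B> a#}"
      have "s \<notin> X" "card (M - {s}) = m - 1" "insert s (M - {s}) = M"
        using 2 M disj finM by (auto simp: card_Diff_singleton)
      then have "lam \<le> size {#B \<in># \<B> \<union># ?I s. t \<le> card (B \<inter> M)#}"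
        using exchange_covering[OF assms(9) a, of s "M - {s}"] 2 \<open>m > 0\<close> by simp
      \<comment> \<open>\<open>?I s\<close> is one summand of \<open>\<B>\<^sub>2\<close>; the
        exchanges with other points of \<open>S\<close> are not counted here.\<close>
      moreover have "?I s \<subseteq># \<B>\<^sub>2"
        using 2 fin unfolding assms(17) by (subst sum.remove[of _ s]) auto
      then have "\<B> \<union># ?I s \<subseteq># ?U"
        unfolding assms(16) by (intro subset_mset.le_supI1 subset_mset.sup_mono subset_mset.order_refl)
      ultimately show ?thesis by (rule mono)
    next
      case 3
      have "general_covering_design (t - 2) (card (X - {a})) (k - n - 1) (m - 2) lam (X - {a}) \<C>"
        using assms(15) CD(7) by simp
      \<comment> \<open>Since \<open>a \<in> X\<close>, the sets \<open>X - {a}\<close> and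
        \<open>insert a S\<close> partition \<open>X \<union> S\<close>; they serve as
        \<open>Y\<close> and \<open>T\<close>.\<close>
      then have "lam \<le> size {#B \<in># {#C \<union> insert a S. C \<in># \<C>#}. t \<le> card (B \<inter> M)#}"
        using 3 M fin disj by (intro extended_covering) auto
      then show ?thesis
        by (rule mono) (simp add: assms(18) subseteq_mset_def)
    qed
  qed
  have "card (X \<union> S) = v + n"
    using fin disj BD(7) cardS by (simp add: card_Un_disjoint)
  then show ?thesis
    unfolding general_covering_design_def
    using block cover assms(1-6) BD(2-5) fin by auto
qed

end
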